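(* Let $n \geq 2$ be an integer and let $\mathbf{x} = (x_1,\ldots,x_n) \in \mathbb{N}^n$ be a perfect tuple, i.e. $\|\mathbf{x}\|_1 = 2^{n-1}$. Then $\mathbf{x}$ is admissible if and only if $\mathbf{x}$ is even.
   Context: $\mathbb{N}$ denotes the non-negative integers (including $0$). $Q^n$ denotes the $n$-dimensional hypercube graph: its vertex set is $\{0,1\}^n$ (identified with $\mathbb{F}_2^n$), and two vertices are adjacent if and only if they differ in exactly one coordinate. A matching in $Q^n$ is a set of pairwise vertex-disjoint edges (not necessarily covering all vertices). The profile of a matching $M \subseteq Q^n$ is the vector $\mathbf{x}=(x_1,\ldots,x_n) \in \mathbb{N}^n$ such that, for each $i$, $M$ contains exactly $x_i$ edges whose endpoints differ in the $i$th coordinate. A tuple $\mathbf{x} \in \mathbb{N}^n$ is admissible if it is the profile of some matching in $Q^n$; it is even if every $x_i$ is even; it is perfect if $\|\mathbf{x}\|_1 := \sum_{i=1}^n x_i = 2^{n-1}$. *)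

theory Defs
  imports Main "HOL-Library.FuncSet" "HOL-Library.Disjoint_Sets"
begin

definition cube_verts :: "nat \<Rightarrow> (nat \<Rightarrow> nat) set" where
  "cube_verts n = {1..n} \<rightarrow>\<^sub>E {0, 1}"

definition cube_edges :: "nat \<Rightarrow> (nat \<Rightarrow> nat) set set" where
  "cube_edges n = {{u, v} | u v. u \<in> cube_verts n \<and> v \<in> cube_verts n \<and>
                     (\<exists>!i. i \<in> {1..n} \<and> u i \<noteq> v i)}"

definition cube_matching :: "nat \<Rightarrow> (nat \<Rightarrow> nat) set set \<Rightarrow> bool" where
  "cube_matching n M \<longleftrightarrow> M \<subseteq> cube_edges n \<and> disjoint M"

definition profile :: "(nat \<Rightarrow> nat) set set \<Rightarrow> nat \<Rightarrow> nat" where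
  "profile M i = card {e \<in> M. \<exists>u v. e = {u, v} \<and> u i \<noteq> v i}"

text \<open>A tuple \<open>x\<close> in \<open>\<nat>\<^sup>n\<close> is a function on \<^typ>\<open>nat\<close> of which only the values
  at the indices \<open>1, \<dots>, n\<close> are ever inspected.\<close>

definition admissible :: "nat \<Rightarrow> (nat \<Rightarrow> nat) \<Rightarrow> bool" where
  "admissible n x \<longleftrightarrow> (\<exists>M. cube_matching n M \<and> (\<forall>i\<in>{1..n}. profile M i = x i))"

definition even_tuple :: "nat \<Rightarrow> (nat \<Rightarrow> nat) \<Rightarrow> bool" where
  "even_tuple n x \<longleftrightarrow> (\<forall>i\<in>{1..n}. even (x i))"

definition perfect_tuple :: "nat \<Rightarrow> (nat \<Rightarrow> nat) \<Rightarrow> bool" where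
  "perfect_tuple n x \<longleftrightarrow> (\<Sum>i=1..n. x i) = 2 ^ (n - 1)"

end

theory Submission
  imports Defs
begin

text \<open>
  Necessity: the vertices whose \<open>i\<close>-th coordinate vanishes are even in number, and exactly the
  edges of direction \<open>i\<close> cover an odd number of them.

  Sufficiency, by induction on the dimension, with \<open>x = 2h\<close>. Two perfect matchings of the subcube
  orthogonal to a direction \<open>a\<close>, one placed in each half, give a perfect matching in which any two
  copies of a common edge may be traded for two edges of direction \<open>a\<close>. If \<open>h\<^sub>a\<close> is at least
  the number of other odd entries of \<open>h\<close>, use the same matching in both halves, with every \<open>h\<^sub>j\<close>
  rounded up to an even number (and the remaining slack added to one direction). If \<open>h\<^sub>a = 1\<close>, use
  two different matchings, translated so that they share one edge. For \<open>a\<close> with \<open>h\<^sub>a\<close> maximal the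
  first case can fail only if \<open>n \<le> 6\<close>, because \<open>n(n - 3) < 2\<^bsup>n-2\<^esup>\<close> for \<open>n \<ge> 7\<close>, and then some
  entry equals 1.
\<close>

section \<open>Perfect matchings encoded by edge directions\<close>

text \<open>Symmetric difference with \<open>{i}\<close>: the neighbour of \<open>v\<close> across
  direction \<open>i\<close>.\<close>

definition flip :: "'a \<Rightarrow> 'a set \<Rightarrow> 'a set" where
  "flip i v = {x. (x \<in> v) \<noteq> (x = i)}"

lemma flip_flip [simp]: "flip i (flip i v) = v"
  by (auto simp: flip_def)

lemma mem_flip_self [simp]: "i \<in> flip i v \<longleftrightarrow> i \<notin> v"
  by (auto simp: flip_def)

lemma flip_subset: "v \<subseteq> I \<Longrightarrow> i \<in> I \<Longrightarrow> flip i v \<subseteq> I"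
  by (auto simp: flip_def)

lemma inj_flip: "inj_on (flip i) A"
  by (metis flip_flip inj_onI)

text \<open>Vertices of the cube over \<open>I\<close> are subsets of \<open>I\<close>; a perfect matching is encoded by the
  direction \<open>d v\<close> of the edge covering \<open>v\<close>.\<close>

definition direction_fun :: "'a set \<Rightarrow> ('a set \<Rightarrow> 'a) \<Rightarrow> bool" where
  "direction_fun I d \<longleftrightarrow> (\<forall>v. v \<subseteq> I \<longrightarrow> d v \<in> I \<and> d (flip (d v) v) = d v)"

definition dir_verts :: "'a set \<Rightarrow> ('a set \<Rightarrow> 'a) \<Rightarrow> 'a \<Rightarrow> 'a set set" where
  "dir_verts I d i = {v. v \<subseteq> I \<and> d v = i}"

lemma direction_funD:
  assumes "direction_fun I d" "v \<subseteq> I"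
  shows "d v \<in> I" "d (flip (d v) v) = d v"
  using assms by (auto simp: direction_fun_def)

lemma finite_dir_verts: "finite I \<Longrightarrow> finite (dir_verts I d i)"
  by (rule finite_subset[of _ "Pow I"]) (auto simp: dir_verts_def)

lemma sum_card_dir_verts:
  assumes "finite I" "direction_fun I d"
  shows "(\<Sum>i\<in>I. card (dir_verts I d i)) = 2 ^ card I"
proof -
  have "Pow I = (\<Union>i\<in>I. dir_verts I d i)"
    using assms(2) by (auto simp: dir_verts_def direction_fun_def)
  then have "card (Pow I) = (\<Sum>i\<in>I. card (dir_verts I d i))"
    using assms(1)
    by (auto simp: dir_verts_def[abs_def] intro!: card_UN_disjoint)
  then show ?thesis
    by (simp add: card_Pow assms(1))
qed

text \<open>\<open>flip i\<close> exchanges the two endpoints of each edge of direction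
  \<open>i\<close>, and exactly one endpoint omits \<open>i\<close>. Those endpoints serve below as
  canonical representatives of the edges.\<close>

lemma card_dir_verts_double:
  assumes "finite I" "direction_fun I d" "i \<in> I"
  shows "card (dir_verts I d i) = 2 * card {v \<in> dir_verts I d i. i \<notin> v}"
proof -
  let ?T = "{v \<in> dir_verts I d i. i \<notin> v}"
  have closed: "flip i v \<in> dir_verts I d i" if "v \<in> dir_verts I d i" for v
    using that assms direction_funD[of I d v] flip_subset[of v I i]
    by (auto simp: dir_verts_def)
  have "dir_verts I d i = ?T \<union> flip i ` ?T"
  proof (intro equalityI subsetI)
    fix v assume "v \<in> dir_verts I d i"
    then show "v \<in> ?T \<union> flip i ` ?T"
      using closed[of v] by (cases "i \<in> v") (auto intro!: image_eqI[of _ _ "flip i v"])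
  qed (use closed in auto)
  moreover have "card (?T \<union> flip i ` ?T) = card ?T + card (flip i ` ?T)"
    by (rule card_Un_disjoint) (auto simp: finite_dir_verts assms(1))
  ultimately show ?thesis
    by (simp add: card_image[OF inj_flip])
qed

section \<open>Operations on perfect matchings: gluing, selecting, translating\<close>

text \<open>The condition on \<open>S\<close> says that it is a union of edges common to both
  matchings. Vertices over \<open>S\<close> are rematched along \<open>a\<close>, and all others
  keep the edge of their half. Each vertex of \<open>S\<close> is lost from both halves, whence the
  factor 2; the count is additive to avoid truncated subtraction.\<close>

lemma glue_direction_funs:
  assumes "finite J" "a \<notin> J" "direction_fun J d0" "direction_fun J d1"
    and S: "\<And>v. v \<in> S \<Longrightarrow> v \<subseteq> J \<and> d0 v = d1 v \<and> flip (d0 v) v \<in> S"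
  obtains d where "direction_fun (insert a J) d"
    "\<And>j. j \<in> J \<Longrightarrow> card (dir_verts (insert a J) d j) + 2 * card {v \<in> S. d0 v = j}
        = card (dir_verts J d0 j) + card (dir_verts J d1 j)"
proof -
  define d where "d v = (if v - {a} \<in> S then a else if a \<in> v then d1 (v - {a}) else d0 v)" for v
  \<comment> \<open>Matching edges never leave \<open>S\<close>, so they never enter it either: the
    complement of \<open>S\<close> is a union of edges of both matchings and is unaffected by the
    rematching.\<close>
  have step: "e w \<in> J \<and> flip (e w) w \<notin> S \<and> e (flip (e w) w) = e w"
    if "w \<subseteq> J" "w \<notin> S" "e = d0 \<or> e = d1" for e w
  proof -
    have e: "direction_fun J e" using that assms by auto
    have "flip (e w) w \<notin> S"
    proof
      assume "flip (e w) w \<in> S"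
      from S[OF this] have "flip (e (flip (e w) w)) (flip (e w) w) \<in> S"
        using that(3) by auto
      then show False
        using direction_funD(2)[OF e that(1)] that(2) by simp
    qed
    then show ?thesis using direction_funD[OF e that(1)] by simp
  qed
  have "d v \<in> insert a J \<and> d (flip (d v) v) = d v" if v: "v \<subseteq> insert a J" for v
  proof -
    consider "v - {a} \<in> S" | "v - {a} \<notin> S" "a \<in> v" | "v - {a} \<notin> S" "a \<notin> v" by blast
    then show ?thesis
    proof cases
      case 1
      moreover have "flip a v - {a} = v - {a}" by (auto simp: flip_def)
      ultimately show ?thesis by (simp add: d_def)
    next
      case 2
      define w where "w = v - {a}"
      have w: "d1 w \<in> J" "flip (d1 w) w \<notin> S" "d1 (flip (d1 w) w) = d1 w"
        using step[of w d1] 2 v by (auto simp: w_def)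
      have "flip (d1 w) v - {a} = flip (d1 w) w" "a \<in> flip (d1 w) v"
        using w(1) assms(2) 2 by (auto simp: flip_def w_def)
      then show ?thesis using w 2 by (simp add: d_def w_def)
    next
      case 3
      then have va: "v - {a} = v" by simp
      have w: "d0 v \<in> J" "flip (d0 v) v \<notin> S" "d0 (flip (d0 v) v) = d0 v"
        using step[of v d0] 3 v by auto
      have "flip (d0 v) v - {a} = flip (d0 v) v" "a \<notin> flip (d0 v) v"
        using w(1) assms(2) 3 by (auto simp: flip_def)
      then show ?thesis using w 3 by (simp add: d_def)
    qed
  qed
  then have "direction_fun (insert a J) d" by (simp add: direction_fun_def)
  moreover have "card (dir_verts (insert a J) d j) + 2 * card {v \<in> S. d0 v = j}
      = card (dir_verts J d0 j) + card (dir_verts J d1 j)" if j: "j \<in> J" for j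
  proof -
    let ?A = "dir_verts J d0 j - {v \<in> S. d0 v = j}" and ?B = "dir_verts J d1 j - {v \<in> S. d0 v = j}"
    have fin: "finite (dir_verts J e j)" for e using assms(1) by (rule finite_dir_verts)
    \<comment> \<open>The half without \<open>a\<close> contributes \<open>?A\<close>, the half with
      \<open>a\<close> contributes \<open>?B\<close>. The same set is removed from both because
      \<open>d0\<close> and \<open>d1\<close> agree on \<open>S\<close>.\<close>
    have "dir_verts (insert a J) d j = ?A \<union> insert a ` ?B"
    proof (intro equalityI subsetI)
      fix v assume v: "v \<in> dir_verts (insert a J) d j"
      then have vs: "v \<subseteq> insert a J" "d v = j" by (auto simp: dir_verts_def)
      have nS: "v - {a} \<notin> S" using vs(2) assms(2) j by (auto simp: d_def)
      show "v \<in> ?A \<union> insert a ` ?B"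
      proof (cases "a \<in> v")
        case True
        then have "v - {a} \<in> ?B" "v = insert a (v - {a})"
          using vs nS by (auto simp: dir_verts_def d_def)
        then show ?thesis by blast
      next
        case False
        then show ?thesis using vs nS by (auto simp: dir_verts_def d_def)
      qed
    next
      fix v assume "v \<in> ?A \<union> insert a ` ?B"
      then consider "v \<in> ?A" | w where "v = insert a w" "w \<in> ?B" by blast
      then show "v \<in> dir_verts (insert a J) d j"
      proof cases
        case 1
        then have "a \<notin> v" using assms(2) by (auto simp: dir_verts_def)
        then show ?thesis using 1 by (auto simp: dir_verts_def d_def)
      next
        case 2
        then have "a \<notin> w" using assms(2) by (auto simp: dir_verts_def)
        then show ?thesis using 2 S[of w] by (auto simp: dir_verts_def d_def)
      qed
    qed
    moreover have "card (?A \<union> insert a ` ?B) = card ?A + card (insert a ` ?B)"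
      by (rule card_Un_disjoint) (use fin assms(2) in \<open>auto simp: dir_verts_def\<close>)
    moreover have "card (insert a ` ?B) = card ?B"
      by (rule card_image) (use assms(2) in \<open>force simp: inj_on_def dir_verts_def\<close>)
    moreover have sub: "{v \<in> S. d0 v = j} \<subseteq> dir_verts J d0 j" "{v \<in> S. d0 v = j} \<subseteq> dir_verts J d1 j"
      using S by (auto simp: dir_verts_def)
    moreover have "card ?A = card (dir_verts J d0 j) - card {v \<in> S. d0 v = j}"
      "card ?B = card (dir_verts J d1 j) - card {v \<in> S. d0 v = j}"
      using sub fin by (auto intro!: card_Diff_subset intro: finite_subset)
    moreover have "card {v \<in> S. d0 v = j} \<le> card (dir_verts J d0 j)"
      "card {v \<in> S. d0 v = j} \<le> card (dir_verts J d1 j)"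
      using sub fin by (auto intro!: card_mono)
    ultimately show ?thesis by simp
  qed
  ultimately show ?thesis by (rule that)
qed

text \<open>Choose \<open>k j\<close> edges of each direction \<open>j\<close> through their
  endpoints omitting \<open>j\<close>, then add the opposite endpoints.\<close>

lemma exists_submatching:
  assumes "finite J" "direction_fun J d" "\<And>j. j \<in> J \<Longrightarrow> 2 * k j \<le> card (dir_verts J d j)"
  obtains S where "\<And>v. v \<in> S \<Longrightarrow> v \<subseteq> J \<and> flip (d v) v \<in> S"
    "\<And>j. j \<in> J \<Longrightarrow> card {v \<in> S. d v = j} = 2 * k j"
proof -
  have "\<exists>T. T \<subseteq> {v \<in> dir_verts J d j. j \<notin> v} \<and> card T = k j" if "j \<in> J" for j
  proof -
    have "k j \<le> card {v \<in> dir_verts J d j. j \<notin> v}"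
      using assms(3)[OF that] card_dir_verts_double[OF assms(1,2) that] by simp
    then show ?thesis by (rule obtain_subset_with_card_n) auto
  qed
  then obtain T where T: "\<And>j. j \<in> J \<Longrightarrow> T j \<subseteq> {v \<in> dir_verts J d j. j \<notin> v}"
    "\<And>j. j \<in> J \<Longrightarrow> card (T j) = k j" by metis
  define K where "K j = T j \<union> flip j ` T j" for j
  have K: "v \<subseteq> J" "d v = j" "flip j v \<in> K j" if "j \<in> J" "v \<in> K j" for j v
    using that T(1)[OF that(1)] direction_funD(2)[OF assms(2)] flip_subset[of _ J j]
    by (auto simp: K_def dir_verts_def)
  have "card {v \<in> (\<Union>j\<in>J. K j). d v = j} = 2 * k j" if j: "j \<in> J" for j
  proof -
    have "{v \<in> (\<Union>j\<in>J. K j). d v = j} = K j" using K j by auto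
    moreover have "finite (T j)"
      using T(1)[OF j] finite_dir_verts[OF assms(1)] by (auto intro: finite_subset)
    then have "card (K j) = card (T j) + card (flip j ` T j)"
      unfolding K_def using T(1)[OF j] mem_flip_self[of j] by (intro card_Un_disjoint) blast+
    ultimately show ?thesis by (simp add: T(2)[OF j] card_image[OF inj_flip])
  qed
  then show ?thesis using that[of "\<Union>j\<in>J. K j"] K by fastforce
qed

text \<open>Translation by \<open>t\<close> is an automorphism of the cube that preserves every edge
  direction. It makes it possible to move a given edge of one matching onto a parallel edge of
  another.\<close>

lemma direction_fun_translate:
  assumes "direction_fun J d" "t \<subseteq> J"
  shows "direction_fun J (\<lambda>v. d (sym_diff v t))"
    and "card (dir_verts J (\<lambda>v. d (sym_diff v t)) j) = card (dir_verts J d j)"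
proof -
  have "sym_diff (flip i v) t = flip i (sym_diff v t)" for i v
    by (auto simp: flip_def)
  moreover have "sym_diff v t \<subseteq> J" if "v \<subseteq> J" for v
    using that assms(2) by auto
  ultimately show "direction_fun J (\<lambda>v. d (sym_diff v t))"
    using assms(1) by (simp add: direction_fun_def)
  have "bij_betw (\<lambda>v. sym_diff v t) (dir_verts J (\<lambda>v. d (sym_diff v t)) j) (dir_verts J d j)"
  proof (rule bij_betw_byWitness[where f' = "\<lambda>v. sym_diff v t"])
    have *: "sym_diff (sym_diff v t) t = v" for v by auto
    show "\<forall>v\<in>dir_verts J (\<lambda>v. d (sym_diff v t)) j. sym_diff (sym_diff v t) t = v"
      "\<forall>v\<in>dir_verts J d j. sym_diff (sym_diff v t) t = v" using * by blast+
    show "(\<lambda>v. sym_diff v t) ` dir_verts J (\<lambda>v. d (sym_diff v t)) j \<subseteq> dir_verts J d j"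
      using assms(2) by (auto simp: dir_verts_def)
    show "(\<lambda>v. sym_diff v t) ` dir_verts J d j \<subseteq> dir_verts J (\<lambda>v. d (sym_diff v t)) j"
      using assms(2) * by (auto simp: dir_verts_def simp del: Un_Diff)
  qed
  then show "card (dir_verts J (\<lambda>v. d (sym_diff v t)) j) = card (dir_verts J d j)"
    by (rule bij_betw_same_card)
qed

section \<open>The two inductive steps\<close>

text \<open>The factor is 4 because \<open>h\<close> is half the profile and each edge has two endpoints.\<close>

definition realizable :: "'a set \<Rightarrow> ('a \<Rightarrow> nat) \<Rightarrow> bool" where
  "realizable I h \<longleftrightarrow> (\<exists>d. direction_fun I d \<and> (\<forall>i\<in>I. card (dir_verts I d i) = 4 * h i))"

text \<open>Only the directions in \<open>J\<close> need checking: the total number of vertices then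
  forces the count for \<open>a\<close>.\<close>

lemma realizable_insertI:
  assumes "finite J" "a \<notin> J" "card J \<ge> 1" "h a + sum h J = 2 ^ (card J - 1)"
    and "direction_fun (insert a J) d"
    and "\<And>j. j \<in> J \<Longrightarrow> card (dir_verts (insert a J) d j) = 4 * h j"
  shows "realizable (insert a J) h"
proof -
  have "card (dir_verts (insert a J) d a) + 4 * sum h J = 2 ^ Suc (card J)"
    using sum_card_dir_verts[OF _ assms(5)] assms(1,2,6) by (simp add: sum_distrib_left)
  also have "\<dots> = 4 * (2::nat) ^ (card J - 1)"
    using assms(3) by (cases "card J") auto
  also have "\<dots> = 4 * h a + 4 * sum h J"
    using assms(4) by simp
  finally show ?thesis
    unfolding realizable_def using assms(5,6) by (intro exI[of _ d]) auto
qed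

text \<open>The case of one matching, with half-profile \<open>h'\<close>, used in both halves. Each
  \<open>h j\<close> is at most \<open>2 * h' j\<close>, and the excess is traded for edges of
  direction \<open>a\<close>.\<close>

lemma realizable_double:
  fixes h :: "'a \<Rightarrow> nat"
  assumes "finite J" "a \<notin> J" "card J \<ge> 2" "h a + sum h J = 2 ^ (card J - 1)"
    and odd: "card {j \<in> J. odd (h j)} \<le> h a"
    and IH: "\<And>h'. sum h' J = 2 ^ (card J - 2) \<Longrightarrow> realizable J h'"
  shows "realizable (insert a J) h"
proof -
  define r where "r = card {j \<in> J. odd (h j)}"
  obtain b where b: "b \<in> J" using assms(3) by fastforce
  have pow: "2 ^ (card J - 1) = 2 * (2::nat) ^ (card J - 2)"
    using assms(3) by (metis Suc_diff_le diff_Suc_Suc numeral_2_eq_2 One_nat_def power_Suc)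
  have "r = (\<Sum>j\<in>J. of_bool (odd (h j)))"
    unfolding r_def using assms(1) by (simp add: sum_of_bool_eq Int_def)
  \<comment> \<open>Rounding up costs one unit per odd entry. As the full sum is even,
    \<open>h a\<close> has the parity of \<open>r\<close>, so the slack \<open>h a - r\<close> can
    be halved.\<close>
  then have 1: "2 * (\<Sum>j\<in>J. (h j + 1) div 2) = sum h J + r"
    by (simp add: sum_distrib_left flip: sum.distrib) (rule sum.cong, auto elim!: oddE evenE)
  then have "even (h a + r)" using assms(4) pow by presburger
  then have "even (h a - r)" using odd by (simp add: r_def)
  then obtain k where k: "h a = r + 2 * k" using odd r_def
    by (metis evenE le_add_diff_inverse)
  \<comment> \<open>The halved slack \<open>k\<close> goes to an arbitrary direction
    \<open>b\<close>, which brings the sum of \<open>h'\<close> to exactly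
    \<open>2 ^ (card J - 2)\<close>.\<close>
  define h' where "h' j = (h j + 1) div 2 + (if j = b then k else 0)" for j
  have "2 * sum h' J = 2 * 2 ^ (card J - 2)"
    using 1 k assms(4) pow b assms(1) by (simp add: h'_def sum.distrib)
  then have "realizable J h'" by (intro IH) simp
  then obtain d where d: "direction_fun J d" "\<And>j. j \<in> J \<Longrightarrow> card (dir_verts J d j) = 4 * h' j"
    by (auto simp: realizable_def)
  have le: "h j \<le> 2 * h' j" for j by (simp add: h'_def)
  \<comment> \<open>Two copies give \<open>8 * h' j\<close> vertices of direction \<open>j\<close>;
    trading \<open>2 * h' j - h j\<close> edges in both halves removes
    \<open>4 * (2 * h' j - h j)\<close> of them and leaves \<open>4 * h j\<close>.\<close>
  obtain S where S: "\<And>v. v \<in> S \<Longrightarrow> v \<subseteq> J \<and> flip (d v) v \<in> S"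
    "\<And>j. j \<in> J \<Longrightarrow> card {v \<in> S. d v = j} = 2 * (2 * h' j - h j)"
    by (rule exists_submatching[OF assms(1) d(1), of "\<lambda>j. 2 * h' j - h j"]) (use d(2) in auto)
  obtain e where e: "direction_fun (insert a J) e"
    "\<And>j. j \<in> J \<Longrightarrow> card (dir_verts (insert a J) e j) + 2 * card {v \<in> S. d v = j}
        = card (dir_verts J d j) + card (dir_verts J d j)"
    by (rule glue_direction_funs[OF assms(1,2) d(1) d(1), of S]) (use S(1) in auto)
  show ?thesis
  proof (rule realizable_insertI[OF assms(1,2) _ assms(4) e(1)])
    fix j assume "j \<in> J"
    then show "card (dir_verts (insert a J) e j) = 4 * h j"
      using e(2) S(2) d(2) le[of j] by fastforce
  qed (use assms(3) in simp)
qed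

lemma exists_le_fun_sum:
  fixes f :: "'a \<Rightarrow> nat"
  assumes "finite J" "m \<le> sum f J"
  shows "\<exists>g. (\<forall>j. g j \<le> f j) \<and> sum g J = m"
  using assms
proof (induction J arbitrary: m rule: finite_induct)
  case empty
  then show ?case by auto
next
  case (insert a J)
  \<comment> \<open>\<open>J\<close> takes as much of \<open>m\<close> as it can hold;
    \<open>a\<close> receives the rest.\<close>
  then obtain g where g: "\<And>j. g j \<le> f j" "sum g J = min m (sum f J)"
    by (metis min.cobounded2)
  have "sum (g(a := m - min m (sum f J))) (insert a J) = m"
  proof -
    have "sum (g(a := m - min m (sum f J))) J = sum g J"
      using insert.hyps by (intro sum.cong) auto
    then show ?thesis using insert.hyps g(2) by simp
  qed
  moreover have "\<forall>j. (g(a := m - min m (sum f J))) j \<le> f j"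
    using insert g by auto
  ultimately show ?case by blast
qed

text \<open>Trading the two copies of a single shared edge creates two edges of direction
  \<open>a\<close>, which is exactly \<open>h a = 1\<close>. The shared edge has direction
  \<open>b\<close>.\<close>

lemma realizable_single:
  fixes h :: "'a \<Rightarrow> nat"
  assumes "finite J" "a \<notin> J" "card J \<ge> 2" "h a + sum h J = 2 ^ (card J - 1)"
    and "h a = 1" and b: "b \<in> J" "h b \<ge> 1"
    and IH: "\<And>h'. sum h' J = 2 ^ (card J - 2) \<Longrightarrow> realizable J h'"
  shows "realizable (insert a J) h"
proof -
  define N :: nat where "N = 2 ^ (card J - 2)"
  have N: "N \<ge> 1" by (simp add: N_def)
  have pow: "2 ^ (card J - 1) = 2 * N"
    using assms(3) unfolding N_def by (metis Suc_diff_le diff_Suc_Suc numeral_2_eq_2 One_nat_def power_Suc)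
  \<comment> \<open>One unit at \<open>b\<close> is set aside, so that the remaining
    \<open>2 * (N - 1)\<close> units split evenly between the halves.\<close>
  define f where "f = h(b := h b - 1)"
  have hf: "h j = f j + of_bool (j = b)" for j using b by (simp add: f_def)
  have ind: "(\<Sum>j\<in>J. of_bool (j = b)) = (1::nat)"
    using assms(1) b(1) by (simp add: of_bool_def)
  have "sum h J = sum f J + 1"
    using ind by (simp add: hf sum.distrib)
  then have sf: "sum f J = 2 * (N - 1)" using assms(4,5) pow N by simp
  then obtain g where g: "\<And>j. g j \<le> f j" "sum g J = N - 1"
    using exists_le_fun_sum[OF assms(1), of "N - 1" f] by auto
  \<comment> \<open>Each half gets an edge of direction \<open>b\<close> to share. Together
    \<open>y\<close> and \<open>z\<close> exceed \<open>h\<close> by one unit at \<open>b\<close>,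
    that is by the 4 vertices lost in the trade.\<close>
  define y z where "y j = g j + of_bool (j = b)" and "z j = (f j - g j) + of_bool (j = b)" for j
  have "sum y J = N"
    using g(2) N ind by (simp add: y_def sum.distrib)
  moreover have "(\<Sum>j\<in>J. f j - g j) = N - 1"
    using g sf by (simp add: sum_subtractf_nat)
  then have "sum z J = N"
    using N ind by (simp add: z_def sum.distrib)
  ultimately have "realizable J y" "realizable J z"
    using IH by (auto simp: N_def)
  then obtain d0 d1 where d0: "direction_fun J d0" "\<And>j. j \<in> J \<Longrightarrow> card (dir_verts J d0 j) = 4 * y j"
    and d1: "direction_fun J d1" "\<And>j. j \<in> J \<Longrightarrow> card (dir_verts J d1 j) = 4 * z j"
    unfolding realizable_def by metis
  have "dir_verts J d0 b \<noteq> {}" "dir_verts J d1 b \<noteq> {}"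
    using d0(2)[OF b(1)] d1(2)[OF b(1)] by (auto simp: y_def z_def)
  then obtain v0 v1 where v: "v0 \<subseteq> J" "d0 v0 = b" "v1 \<subseteq> J" "d1 v1 = b"
    by (auto simp: dir_verts_def)
  \<comment> \<open>This translation carries \<open>v0\<close> to \<open>v1\<close>, so the
    translated matching contains the edge of \<open>d0\<close> at \<open>v0\<close>.\<close>
  define t where "t = sym_diff v0 v1"
  have t: "t \<subseteq> J" "sym_diff v0 t = v1" using v by (auto simp: t_def)
  define d2 where "d2 v = d1 (sym_diff v t)" for v
  have d2: "direction_fun J d2" "\<And>j. j \<in> J \<Longrightarrow> card (dir_verts J d2 j) = 4 * z j"
    unfolding d2_def using direction_fun_translate[OF d1(1) t(1)] d1(2) by auto
  have d2v: "d2 v0 = b" using t v by (simp add: d2_def)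
  define S where "S = {v0, flip b v0}"
  have Sb: "d0 v = b \<and> d2 v = b \<and> v \<subseteq> J \<and> flip b v \<in> S" if "v \<in> S" for v
    using that v(1,2) d2v direction_funD(2)[OF d0(1) v(1)] direction_funD(2)[OF d2(1) v(1)]
      flip_subset[OF v(1) b(1)] by (auto simp: S_def)
  have "v0 \<noteq> flip b v0" using mem_flip_self[of b v0] by blast
  then have cS: "card {v \<in> S. d0 v = j} = 2 * of_bool (j = b)" for j
  proof -
    have "{v \<in> S. d0 v = j} = (if j = b then S else {})" using Sb by auto
    moreover have "card S = 2" using \<open>v0 \<noteq> flip b v0\<close> by (simp add: S_def)
    ultimately show ?thesis by simp
  qed
  obtain e where e: "direction_fun (insert a J) e"
    "\<And>j. j \<in> J \<Longrightarrow> card (dir_verts (insert a J) e j) + 2 * card {v \<in> S. d0 v = j}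
        = card (dir_verts J d0 j) + card (dir_verts J d2 j)"
    by (rule glue_direction_funs[OF assms(1,2) d0(1) d2(1), of S]) (use Sb in auto)
  show ?thesis
  proof (rule realizable_insertI[OF assms(1,2) _ assms(4) e(1)])
    fix j assume j: "j \<in> J"
    show "card (dir_verts (insert a J) e j) = 4 * h j"
      using e(2)[OF j] d0(2)[OF j] d2(2)[OF j] cS[of j] g(1)[of j] hf[of j]
      by (simp add: y_def z_def)
  qed (use assms(3) in simp)
qed

section \<open>Choosing the splitting direction, and the induction\<close>

text \<open>The bound 7 is sharp: at \<open>n = 6\<close> the two sides are 18 and 16.\<close>

lemma power_gt_quadratic:
  fixes n :: nat
  assumes "n \<ge> 7"
  shows "n * (n - 3) < 2 ^ (n - 2)"
  using assms
proof (induction n rule: dec_induct)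
  case (step n)
  obtain m where m: "n = m + 7" using step.hyps by (metis add.commute le_Suc_ex)
  have "Suc n * (Suc n - 3) \<le> 2 * (n * (n - 3))"
    by (simp add: m algebra_simps)
  also have "\<dots> < 2 * 2 ^ (n - 2)" using step by simp
  also have "\<dots> = 2 ^ (Suc n - 2)" by (simp add: m flip: power_Suc)
  finally show ?case .
qed simp

text \<open>If both alternatives fail, a maximal entry \<open>h a\<close> is smaller than the number
  of other odd entries, all of which are at least 3. The total is then too small in dimension 7 and
  above, and too large in dimension 6.\<close>

lemma double_or_single:
  fixes h :: "'a \<Rightarrow> nat"
  assumes "finite I" "card I \<ge> 3" "sum h I = 2 ^ (card I - 2)"
  shows "(\<exists>a\<in>I. card {j \<in> I - {a}. odd (h j)} \<le> h a) \<or>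
         (\<exists>a\<in>I. \<exists>b\<in>I - {a}. h a = 1 \<and> h b \<ge> 1)"
proof (rule ccontr)
  assume neg: "\<not> ?thesis"
  have ne: "I \<noteq> {}" using assms(2) by auto
  define a where "a = (SOME a. a \<in> I \<and> h a = Max (h ` I))"
  have "\<exists>a. a \<in> I \<and> h a = Max (h ` I)"
    using Max_in[of "h ` I"] assms(1) ne by fastforce
  then have a: "a \<in> I" "h a = Max (h ` I)" unfolding a_def by (metis (mono_tags, lifting) someI_ex)+
  have max: "h j \<le> h a" if "j \<in> I" for j using a assms(1) that by simp
  define R where "R = {j \<in> I - {a}. odd (h j)}"
  have finR: "finite R" and RI: "R \<subseteq> I - {a}" using assms(1) by (auto simp: R_def)
  have lt: "h a < card R" using neg a by (force simp: R_def)
  have sumI: "sum h I = h a + sum h (I - {a})" using assms(1) a(1) by (simp add: sum.remove)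
  \<comment> \<open>The total is a positive power of 2, as \<open>card I\<close> is at least 3.
    Parity then widens the gap between \<open>h a\<close> and \<open>card R\<close> from 1 to
    2.\<close>
  have "even (sum h I)" using assms(2,3) by (auto simp: le_Suc_ex)
  moreover have "even (sum h (I - {a})) = even (card R)"
    using assms(1) even_sum_iff[of "I - {a}" h] by (simp add: R_def)
  ultimately have "even (h a) = even (card R)" using sumI by simp
  then have R2: "h a + 2 \<le> card R" using lt by presburger
  have Rn: "card R + 1 \<le> card I"
    using card_mono[OF _ RI] assms(1) a(1) by (simp add: card_Diff_singleton) (use assms(2) in linarith)
  \<comment> \<open>An entry 1 in \<open>R\<close> would give the second alternative, with the
    nonzero maximal entry as its partner.\<close>
  have "h j \<noteq> 1" if "j \<in> R" for j
  proof
    assume "h j = 1"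
    moreover have "j \<in> I" "a \<in> I - {j}" using that a by (auto simp: R_def)
    moreover have "h a \<ge> 1" using max[of j] \<open>h j = 1\<close> \<open>j \<in> I\<close> by simp
    ultimately show False using neg by blast
  qed
  then have R3: "h j \<ge> 3" if "j \<in> R" for j
    using that by (fastforce simp: R_def elim: oddE)
  obtain j where "j \<in> R" using lt by fastforce
  then have ha: "h a \<ge> 3" using R3 max[of j] by (fastforce simp: R_def)
  have "3 * card R \<le> sum h R"
    using sum_bounded_below[of R 3 h] R3 by (simp add: mult.commute)
  also have "\<dots> \<le> sum h (I - {a})" using assms(1) RI by (intro sum_mono2) auto
  \<comment> \<open>Here 18 is 3 for \<open>a\<close> plus 3 for each of at least 5 elements of
    \<open>R\<close>; the total in dimension 6 is only 16.\<close>
  finally have low: "18 \<le> sum h I" using sumI ha R2 by linarith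
  have n6: "card I \<ge> 6" using ha R2 Rn by linarith
  have "sum h I \<le> card I * h a"
    using sum_bounded_above[of I h "h a"] max by simp
  also have "\<dots> \<le> card I * (card I - 3)"
    using R2 Rn by (intro mult_le_mono2) linarith
  finally have "\<not> card I \<ge> 7" using power_gt_quadratic[of "card I"] assms(3) by linarith
  then have "card I = 6" using n6 by linarith
  then show False using low assms(3) by simp
qed

lemma realizable_if_sum:
  fixes h :: "'a \<Rightarrow> nat"
  assumes "finite I" "card I \<ge> 2" "sum h I = 2 ^ (card I - 2)"
  shows "realizable I h"
  using assms
proof (induction "card I" arbitrary: I h rule: less_induct)
  case (less I h)
  show ?case
  proof (cases "card I = 2")
    \<comment> \<open>In the square the total is 1, so all edges are parallel: a constant direction
      function covers the 4 vertices.\<close>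
    case True
    then have "sum h I = Suc 0" using less.prems by simp
    then obtain a where a: "a \<in> I" "h a = 1" "\<forall>b\<in>I. a \<noteq> b \<longrightarrow> h b = 0"
      using sum_eq_Suc0_iff[OF less.prems(1)] by auto
    have "dir_verts I (\<lambda>_. a) i = (if i = a then Pow I else {})" for i
      by (auto simp: dir_verts_def)
    then show ?thesis
      unfolding realizable_def using a less.prems(1) True
      by (intro exI[of _ "\<lambda>_. a"]) (auto simp: direction_fun_def card_Pow)
  next
    case False
    then have n3: "card I \<ge> 3" using less.prems by simp
    have red: "\<exists>J. J = I - {a} \<and> I = insert a J \<and> finite J \<and> a \<notin> J \<and> card J \<ge> 2 \<and>
        h a + sum h J = 2 ^ (card J - 1) \<and>
        (\<forall>h'. sum h' J = 2 ^ (card J - 2) \<longrightarrow> realizable J h')" if a: "a \<in> I" for a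
    proof -
      let ?J = "I - {a}"
      have c: "card ?J = card I - 1" using less.prems(1) a by simp
      have "card ?J < card I" "card ?J \<ge> 2" using c n3 by auto
      then have "\<forall>h'. sum h' ?J = 2 ^ (card ?J - 2) \<longrightarrow> realizable ?J h'"
        using less.hyps[of ?J] less.prems(1) by blast
      moreover have "card ?J - 1 = card I - 2" using c by simp
      then have "h a + sum h ?J = 2 ^ (card ?J - 1)"
        using less.prems a by (simp only: sum.remove[OF less.prems(1) a, symmetric])
      ultimately show ?thesis using \<open>card ?J \<ge> 2\<close> less.prems(1) a by auto
    qed
    from double_or_single[OF less.prems(1) n3 less.prems(3)] show ?thesis
    proof
      assume "\<exists>a\<in>I. card {j \<in> I - {a}. odd (h j)} \<le> h a"
      then obtain a where a: "a \<in> I" "card {j \<in> I - {a}. odd (h j)} \<le> h a" by blast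
      then show ?thesis using red[OF a(1)] realizable_double[of "I - {a}" a h] by auto
    next
      assume "\<exists>a\<in>I. \<exists>b\<in>I - {a}. h a = 1 \<and> h b \<ge> 1"
      then obtain a b where ab: "a \<in> I" "b \<in> I - {a}" "h a = 1" "h b \<ge> 1" by blast
      then show ?thesis using red[OF ab(1)] realizable_single[of "I - {a}" a h b] by auto
    qed
  qed
qed

section \<open>Sufficiency: back to matchings as sets of edges\<close>

lemma admissible_if_even:
  assumes "n \<ge> 2" "perfect_tuple n x" "even_tuple n x"
  shows "admissible n x"
proof -
  define I where "I = {1..n}"
  define h where "h i = x i div 2" for i
  have x: "x i = 2 * h i" if "i \<in> I" for i
    using assms(3) that by (simp add: even_tuple_def I_def h_def)
  have "2 * sum h I = 2 ^ (n - 1)"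
    using assms(2) x by (simp add: perfect_tuple_def I_def sum_distrib_left)
  also have "\<dots> = 2 * 2 ^ (n - 2)"
    using assms(1) by (metis Suc_diff_le diff_Suc_Suc numeral_2_eq_2 One_nat_def power_Suc)
  finally have "realizable I h"
    using assms(1) by (intro realizable_if_sum) (simp_all add: I_def)
  then obtain d where d: "direction_fun I d" "\<And>i. i \<in> I \<Longrightarrow> card (dir_verts I d i) = 4 * h i"
    by (auto simp: realizable_def)
  \<comment> \<open>Characteristic functions, restricted to \<open>I\<close> because cube vertices
    are extensional functions.\<close>
  define chi :: "nat set \<Rightarrow> nat \<Rightarrow> nat"
    where "chi s = restrict (\<lambda>i. of_bool (i \<in> s)) I" for s
  have chi_neq: "chi s i \<noteq> chi t i \<longleftrightarrow> (i \<in> s) \<noteq> (i \<in> t)" if "i \<in> I" for s t i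
    using that by (simp add: chi_def)
  have chi_eq: "chi s = chi t \<longleftrightarrow> s = t" if "s \<subseteq> I" "t \<subseteq> I" for s t
  proof
    assume eq: "chi s = chi t"
    have "i \<in> s \<longleftrightarrow> i \<in> t" if "i \<in> I" for i
      using chi_neq[OF that, of s t] eq by simp
    then show "s = t" using that by blast
  qed simp
  have chi_verts: "chi s \<in> cube_verts n" for s
    by (auto simp: chi_def cube_verts_def I_def)
  define m where "m s = flip (d s) s" for s
  have m: "m s \<subseteq> I" "d s \<in> I" "m (m s) = s" "d (m s) = d s" if "s \<subseteq> I" for s
    using direction_funD[OF d(1) that] flip_subset[OF that] by (auto simp: m_def)
  define edge where "edge s = {chi s, chi (m s)}" for s
  have chi_m: "chi s i \<noteq> chi (m s) i \<longleftrightarrow> i = d s" if "s \<subseteq> I" "i \<in> I" for s i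
    using chi_neq[OF that(2), of s "m s"] by (auto simp: m_def flip_def)
  have edge_m: "edge (m s) = edge s" if "s \<subseteq> I" for s
    using m[OF that] by (auto simp: edge_def)
  \<comment> \<open>An edge is named by either of its endpoints and by no other vertex. This yields
    both disjointness and, on representatives, injectivity of \<open>edge\<close>.\<close>
  have meet: "t = s \<or> t = m s" if "s \<subseteq> I" "t \<subseteq> I" "edge s \<inter> edge t \<noteq> {}" for s t
  proof -
    have "s = t \<or> s = m t \<or> m s = t \<or> m s = m t"
      using that m(1) by (auto simp: edge_def chi_eq)
    then show ?thesis using m(3)[OF that(1)] m(3)[OF that(2)] by metis
  qed
  define M where "M = edge ` Pow I"
  have "M \<subseteq> cube_edges n"
  proof
    fix e assume "e \<in> M"
    then obtain s where s: "s \<subseteq> I" "e = {chi s, chi (m s)}" by (auto simp: M_def edge_def)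
    have "\<exists>!i. i \<in> {1..n} \<and> chi s i \<noteq> chi (m s) i"
      using chi_m[OF s(1)] m(2)[OF s(1)] unfolding I_def[symmetric] by (intro ex1I[of _ "d s"]) auto
    then show "e \<in> cube_edges n"
      unfolding cube_edges_def using s(2) chi_verts by (intro CollectI exI conjI)
  qed
  moreover have "disjoint M"
  proof (rule disjointI)
    fix e f assume "e \<in> M" "f \<in> M" "e \<noteq> f"
    then obtain s t where st: "s \<subseteq> I" "e = edge s" "t \<subseteq> I" "f = edge t" by (auto simp: M_def)
    then show "e \<inter> f = {}" using meet[of s t] edge_m[of s] \<open>e \<noteq> f\<close> by metis
  qed
  moreover have "profile M i = x i" if i: "i \<in> I" for i
  proof -
    let ?T = "{s \<in> dir_verts I d i. i \<notin> s}"
    have "{e \<in> M. \<exists>u v. e = {u, v} \<and> u i \<noteq> v i} = edge ` ?T"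
    proof (intro equalityI subsetI)
      fix e assume "e \<in> {e \<in> M. \<exists>u v. e = {u, v} \<and> u i \<noteq> v i}"
      then obtain s u v where s: "s \<subseteq> I" "e = edge s" "edge s = {u, v}" "u i \<noteq> v i"
        by (auto simp: M_def)
      then have "chi s i \<noteq> chi (m s) i" by (auto simp: edge_def doubleton_eq_iff)
      then have "d s = i" using chi_m[OF s(1) i] by simp
      then have "s \<in> ?T \<or> m s \<in> ?T"
        using s(1) m[OF s(1)] by (auto simp: dir_verts_def m_def)
      then show "e \<in> edge ` ?T" using s(2) edge_m[OF s(1)] by blast
    next
      fix e assume "e \<in> edge ` ?T"
      then obtain s where s: "s \<subseteq> I" "d s = i" "e = edge s" by (auto simp: dir_verts_def)
      then have "chi s i \<noteq> chi (m s) i" using chi_m[OF s(1) i] by simp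
      then show "e \<in> {e \<in> M. \<exists>u v. e = {u, v} \<and> u i \<noteq> v i}"
        using s by (auto simp: M_def edge_def)
    qed
    moreover have "inj_on edge ?T"
    proof (rule inj_onI)
      fix s t assume st: "s \<in> ?T" "t \<in> ?T" "edge s = edge t"
      then have "t = s \<or> t = m s" using meet[of s t] by (auto simp: dir_verts_def edge_def)
      then show "s = t" using st by (auto simp: dir_verts_def m_def)
    qed
    ultimately have "profile M i = card ?T" by (simp add: profile_def card_image)
    then show ?thesis
      using card_dir_verts_double[OF _ d(1) i] d(2)[OF i] x[OF i] by (simp add: I_def)
  qed
  ultimately show ?thesis
    unfolding admissible_def cube_matching_def I_def by blast
qed

section \<open>Necessity: parity on a facet\<close>

lemma even_if_admissible:
  assumes "n \<ge> 2" "perfect_tuple n x" "admissible n x"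
  shows "even_tuple n x"
proof -
  obtain M where M: "M \<subseteq> cube_edges n" "disjoint M" and prof: "\<And>i. i \<in> {1..n} \<Longrightarrow> profile M i = x i"
    using assms(3) by (auto simp: admissible_def cube_matching_def)
  let ?P = "\<lambda>e i. \<exists>u v. e = {u, v} \<and> u i \<noteq> v i"
  have edgeE: "\<exists>u v j. e = {u, v} \<and> u \<noteq> v \<and> u \<in> cube_verts n \<and> v \<in> cube_verts n \<and> j \<in> {1..n} \<and>
      (\<forall>i\<in>{1..n}. u i \<noteq> v i \<longleftrightarrow> i = j)" if "e \<in> M" for e
  proof -
    have "e \<in> cube_edges n" using that M(1) by blast
    then obtain u v where uv: "e = {u, v}" "u \<in> cube_verts n" "v \<in> cube_verts n"
      "\<exists>!i. i \<in> {1..n} \<and> u i \<noteq> v i"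
      unfolding cube_edges_def by (elim CollectE exE conjE)
    from uv(4) obtain j where j: "j \<in> {1..n} \<and> u j \<noteq> v j"
      "\<forall>i. i \<in> {1..n} \<and> u i \<noteq> v i \<longrightarrow> i = j"
      by (elim ex1E)
    have "u \<noteq> v" using j(1) by metis
    moreover have "\<forall>i\<in>{1..n}. u i \<noteq> v i \<longleftrightarrow> i = j" using j by metis
    ultimately have "e = {u, v} \<and> u \<noteq> v \<and> u \<in> cube_verts n \<and> v \<in> cube_verts n \<and> j \<in> {1..n} \<and>
      (\<forall>i\<in>{1..n}. u i \<noteq> v i \<longleftrightarrow> i = j)" using uv(1-3) j(1) by (intro conjI) simp_all
    then show ?thesis by (intro exI)
  qed
  have P: "?P {u, v} i \<longleftrightarrow> u i \<noteq> v i" for u v :: "nat \<Rightarrow> nat" and i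
    by (auto simp: doubleton_eq_iff)
  have finV: "finite (cube_verts n)" and cardV: "card (cube_verts n) = 2 ^ n"
    by (simp_all add: cube_verts_def card_PiE finite_PiE numeral_2_eq_2)
  have sub: "e \<subseteq> cube_verts n" and card_e: "card e = 2" if "e \<in> M" for e
    using edgeE[OF that] by auto
  have "M \<subseteq> Pow (cube_verts n)" using sub by blast
  then have finM: "finite M" using finV by (auto intro: finite_subset)
  \<comment> \<open>Every edge has exactly one direction, so summing the profile counts each edge
    once and gives \<open>card M\<close>.\<close>
  have one: "(\<Sum>i\<in>{1..n}. of_bool (?P e i)) = (1::nat)" if e: "e \<in> M" for e
  proof -
    obtain u v j where "e = {u, v}" "j \<in> {1..n}" "\<And>i. i \<in> {1..n} \<Longrightarrow> u i \<noteq> v i \<longleftrightarrow> i = j"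
      using edgeE[OF e] by metis
    then have "(\<Sum>i\<in>{1..n}. of_bool (?P e i)) = (\<Sum>i\<in>{1..n}. if i = j then 1 else 0 :: nat)"
      by (intro sum.cong) (simp_all add: P)
    then show ?thesis using \<open>j \<in> {1..n}\<close> by simp
  qed
  have "profile M i = (\<Sum>e\<in>M. of_bool (?P e i))" for i
    using finM by (simp add: profile_def sum_of_bool_eq Int_def)
  then have "(\<Sum>i\<in>{1..n}. x i) = (\<Sum>i\<in>{1..n}. \<Sum>e\<in>M. of_bool (?P e i))"
    using prof by simp
  also have "\<dots> = (\<Sum>e\<in>M. \<Sum>i\<in>{1..n}. of_bool (?P e i))"
    by (rule sum.swap)
  also have "\<dots> = card M" using one by simp
  finally have cardM: "card M = 2 ^ (n - 1)"
    using assms(2) by (simp add: perfect_tuple_def)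
  \<comment> \<open>A matching of \<open>2 ^ (n - 1)\<close> edges covers \<open>2 ^ n\<close>
    vertices, hence the whole cube.\<close>
  have "card (\<Union>M) = sum card M"
    using M(2) sub finV by (intro card_Union_disjoint) (auto intro: finite_subset)
  also have "\<dots> = 2 * 2 ^ (n - 1)" using card_e cardM by simp
  also have "\<dots> = card (cube_verts n)" using cardV assms(1) by (simp flip: power_Suc)
  finally have cover: "\<Union>M = cube_verts n"
    using sub finV by (intro card_subset_eq) auto
  have "even (x i)" if i: "i \<in> {1..n}" for i
  proof -
    define H where "H = {v \<in> cube_verts n. v i = 0}"
    \<comment> \<open>A second direction exists as \<open>n\<close> is at least 2; its factor 2 in
      the product makes the facet \<open>H\<close> even.\<close>
    obtain j where j: "j \<in> {1..n}" "j \<noteq> i"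
      using assms(1) that[of "if i = 1 then 2 else 1"] by auto
    have "H = PiE {1..n} (\<lambda>k. if k = i then {0} else {0, 1})"
      unfolding H_def cube_verts_def using i by (auto simp: PiE_iff extensional_def split: if_splits)
    then have "card H = (\<Prod>k\<in>{1..n}. if k = i then 1 else 2)"
      by (simp add: card_PiE if_distrib numeral_2_eq_2 cong: if_cong)
    then have "even (card H)"
      using dvd_prodI[of "{1..n}" j "\<lambda>k. if k = i then 1 else 2 :: nat"] j by simp
    moreover have "card H = (\<Sum>e\<in>M. card (e \<inter> H))"
    proof -
      have "H = (\<Union>e\<in>M. e \<inter> H)" using cover by (auto simp: H_def)
      moreover have "card (\<Union>e\<in>M. e \<inter> H) = (\<Sum>e\<in>M. card (e \<inter> H))"
        using finM M(2) finV by (intro card_UN_disjoint) (auto simp: H_def disjoint_def)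
      ultimately show ?thesis by simp
    qed
    ultimately have "even (card {e \<in> M. odd (card (e \<inter> H))})"
      using even_sum_iff[OF finM, of "\<lambda>e. card (e \<inter> H)"] by simp
    \<comment> \<open>An edge of direction \<open>i\<close> has one endpoint in \<open>H\<close>;
      any other edge has none or two.\<close>
    moreover have "odd (card (e \<inter> H)) \<longleftrightarrow> ?P e i" if e: "e \<in> M" for e
    proof -
      obtain u v where uv: "e = {u, v}" "u \<noteq> v" "u \<in> cube_verts n" "v \<in> cube_verts n"
        using edgeE[OF e] by metis
      have "e \<inter> H = (if u i = 0 then {u} else {}) \<union> (if v i = 0 then {v} else {})"
        using uv by (auto simp: H_def)
      moreover have "u i \<in> {0, 1}" "v i \<in> {0, 1}"
        using uv i by (auto simp: cube_verts_def)
      ultimately show ?thesis using uv(2) by (auto simp: uv(1) P)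
    qed
    then have "{e \<in> M. odd (card (e \<inter> H))} = {e \<in> M. ?P e i}" by blast
    ultimately show ?thesis using prof[OF i] by (simp add: profile_def)
  qed
  then show ?thesis by (simp add: even_tuple_def)
qed

theorem theorem1p3:
  fixes n :: nat and x :: "nat \<Rightarrow> nat"
  assumes "n \<ge> 2" and "perfect_tuple n x"
  shows "admissible n x \<longleftrightarrow> even_tuple n x"
  using assms admissible_if_even even_if_admissible by blast

end
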